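(* Let $p\colon\mathbb{N}\to(0,1)$. If $\limsup_{n\to\infty} p(n) < 1/4$, then asymptotically almost surely every orientation of the binomial random graph $G(n,p)$ contains a Seymour vertex; that is, $\Pr\bigl[\text{every orientation of } G(n,p(n)) \text{ contains a Seymour vertex}\bigr]\to 1$ as $n\to\infty$.
   Context: $G(n,p)$ is the random graph with vertex set $\{1,\dots,n\}$ in which every pair of vertices appears as an edge independently and with probability $p=p(n)$. An orientation of a simple graph $G$ is a digraph obtained by assigning a direction to each edge of $G$ (so it has no loops, no parallel arcs, and no directed cycles of length $2$). For a vertex $u$ of an oriented graph and $i\in\mathbb{N}$, $N^i(u)$ is the set of vertices $v$ for which a shortest directed path from $u$ to $v$ has precisely $i$ arcs. A Seymour vertex is a vertex $u$ with $|N^2(u)|\ge |N^1(u)|$. *)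

theory Defs
  imports "HOL-Probability.Probability" "Graph_Theory.Graph_Theory"
begin

text \<open>
  As in the library, a finite simple graph is a finite loop-free digraph whose arc relation is
  symmetric (locale \<open>pair_graph\<close>): the edge between \<open>u\<close> and \<open>v\<close> is the pair of arcs
  \<open>(u, v)\<close>, \<open>(v, u)\<close>.
\<close>

definition pairs_upto :: "nat \<Rightarrow> nat set set" where
  "pairs_upto n = {e. e \<subseteq> {1..n} \<and> card e = 2}"

text \<open>
  One independent Bernoulli variable per two-element subset of \<open>{1..n}\<close>. The product takes the
  default value \<open>False\<close> on every other set, in particular on the singletons \<open>{u, u}\<close>, so
  that no loops arise.
\<close>

definition binomial_random_graph :: "nat \<Rightarrow> real \<Rightarrow> nat pair_pre_digraph pmf" where
  "binomial_random_graph n p =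
     map_pmf (\<lambda>X. \<lparr>pverts = {1..n}, parcs = {(u, v). X {u, v}}\<rparr>)
       (Pi_pmf (pairs_upto n) False (\<lambda>_. bernoulli_pmf p))"

definition orientation :: "'a pair_pre_digraph \<Rightarrow> 'a pair_pre_digraph \<Rightarrow> bool" where
  "orientation G D \<longleftrightarrow>
     pverts D = pverts G \<and> parcs D \<subseteq> parcs G \<and>
     (\<forall>(u, v) \<in> parcs G. (u, v) \<in> parcs D \<longleftrightarrow> (v, u) \<notin> parcs D)"

definition shortest_path :: "('a, 'b) pre_digraph \<Rightarrow> 'a \<Rightarrow> 'b awalk \<Rightarrow> 'a \<Rightarrow> bool" where
  "shortest_path D u q v \<longleftrightarrow> is_arg_min length (\<lambda>q. pre_digraph.apath D u q v) q"

definition out_layer :: "('a, 'b) pre_digraph \<Rightarrow> nat \<Rightarrow> 'a \<Rightarrow> 'a set" where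
  "out_layer D i u = {v. \<exists>q. shortest_path D u q v \<and> length q = i}"

text \<open>For finite digraphs only: \<open>card\<close> is \<open>0\<close> on infinite layers.\<close>

definition seymour_vertex :: "('a, 'b) pre_digraph \<Rightarrow> 'a \<Rightarrow> bool" where
  "seymour_vertex D u \<longleftrightarrow> u \<in> verts D \<and> card (out_layer D 2 u) \<ge> card (out_layer D 1 u)"


lemma finite_pairs_upto: "finite (pairs_upto n)"
  by (rule finite_subset[of _ "Pow {1..n}"]) (auto simp: pairs_upto_def)

lemma pair_graph_binomial_random_graph:
  assumes "G \<in> set_pmf (binomial_random_graph n p)"
  shows "pair_graph G"
proof -
  obtain X where G: "G = \<lparr>pverts = {1..n}, parcs = {(u, v). X {u, v}}\<rparr>"
    and "X \<in> set_pmf (Pi_pmf (pairs_upto n) False (\<lambda>_. bernoulli_pmf p))"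
    using assms unfolding binomial_random_graph_def set_map_pmf by (rule imageE)
  then have X: "e \<in> pairs_upto n" if "X e" for e
    using set_Pi_pmf_subset[OF finite_pairs_upto] that by fast
  have *: "u \<in> {1..n} \<and> v \<in> {1..n} \<and> u \<noteq> v" if "(u, v) \<in> parcs G" for u v
  proof -
    have "{u, v} \<subseteq> {1..n}" "card {u, v} = 2"
      using X[of "{u, v}"] that G by (simp_all add: pairs_upto_def)
    then show ?thesis by (cases "u = v") simp_all
  qed
  have fin: "finite (parcs G)"
    by (rule finite_subset[of _ "{1..n} \<times> {1..n}"]) (use * in force)+
  have sym: "symmetric (with_proj G)"
    using G by (simp add: symmetric_def sym_def insert_commute)
  have V: "pverts G = {1..n}" using G by simp
  show ?thesis
  proof
    show "fst e \<in> pverts G" "snd e \<in> pverts G" "fst e \<noteq> snd e" if "e \<in> parcs G" for e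
      using *[of "fst e" "snd e"] that V by simp_all
  qed (use fin sym V in simp_all)
qed

lemma orientation_oriented:
  assumes "pair_graph G" "orientation G D"
  shows "pair_digraph D" "antisym (parcs D)"
proof -
  interpret pair_graph G by fact
  have ex: "(u, v) \<in> parcs D \<longleftrightarrow> (v, u) \<notin> parcs D" if "(u, v) \<in> parcs G" for u v
    using assms(2) that by (auto simp: orientation_def)
  have D: "pverts D = pverts G" "parcs D \<subseteq> parcs G"
    using assms(2) by (simp_all add: orientation_def)
  show "pair_digraph D"
  proof
    show "fst e \<in> pverts D" "snd e \<in> pverts D" "fst e \<noteq> snd e" if "e \<in> parcs D" for e
      using that D arc_fst_in_verts[of e] arc_snd_in_verts[of e] pair_no_loops[of e] by auto
    show "finite (pverts D)" using D pair_finite_verts by simp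
    show "finite (parcs D)" using D pair_finite_arcs finite_subset by blast
  qed
  show "antisym (parcs D)"
    using ex D(2) by (meson antisymI subsetD)
qed

end

theory Submission
  imports Defs "HOL-Real_Asymp.Real_Asymp"
begin

text \<open>
  In an orientation without Seymour vertex write \<open>d v\<close> for the out-degree of \<open>v\<close>. The arcs leaving
  \<open>N\<^sup>1(v)\<close> end in \<open>N\<^sup>1(v) \<union> N\<^sup>2(v)\<close>, a set of fewer than \<open>2 d v\<close> vertices.

  If \<open>n p \<ge> n\<^bsup>1/10\<^esup>\<close>, Chernoff bounds show that there are at most about \<open>3/2 p (d v)\<^sup>2\<close> such
  arcs. Summing over \<open>v\<close> counts \<open>d w\<close> once for every in-neighbour of \<open>w\<close>; since all degrees are
  close to \<open>n p\<close>, this gives \<open>n p \<Sum> d \<le> (1 + 3/2 p) \<Sum> d\<^sup>2\<close> up to lower order terms. But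
  \<open>\<Sum> d \<approx> p n\<^sup>2 / 2\<close>, while \<open>k\<close> vertices touch only about \<open>p (k n - k\<^sup>2 / 2)\<close> edges, which
  forces \<open>\<Sum> d\<^sup>2 \<le> p\<^sup>2 n\<^sup>3 / 3\<close> approximately. Hence \<open>1/2 \<le> (1 + 3/2 p) / 3\<close>, which fails for
  \<open>p \<le> 1/4\<close>.

  If \<open>n p \<le> n\<^bsup>1/10\<^esup>\<close>, asymptotically almost surely the graph has no subgraph with 4 vertices and 5 edges. For a
  vertex \<open>u\<close> of minimum out-degree, each vertex of \<open>N\<^sup>1(u)\<close> has an out-neighbour in \<open>N\<^sup>1(u)\<close>;
  two steps inside \<open>N\<^sup>1(u)\<close> together with \<open>u\<close> form such a subgraph.
\<close>

subsection \<open>Independent Bernoulli variables\<close>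

lemma exp_le_quadratic:
  fixes x :: real
  assumes "\<bar>x\<bar> \<le> 1"
  shows "exp x \<le> 1 + x + x\<^sup>2"
proof (cases "x \<ge> 0")
  case True
  then show ?thesis using exp_bound[of x] assms by simp
next
  case False
  \<comment> \<open>For negative \<open>x\<close> the factorization 1 + y^3 = (1 + y)(1 - y + y^2)
    turns \<open>1 + y \<le> exp y\<close> into an upper bound for \<open>exp (- y)\<close>.\<close>
  define y where "y = - x"
  have y: "y > 0" using False by (simp add: y_def)
  have "(1 + y) * (1 - y + y\<^sup>2) = 1 + y ^ 3"
    by (simp add: algebra_simps power2_eq_square power3_eq_cube)
  then have "1 \<le> (1 + y) * (1 - y + y\<^sup>2)" using y by simp
  also have "\<dots> \<le> exp y * (1 - y + y\<^sup>2)"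
  proof (rule mult_right_mono)
    have "(1 - y + y\<^sup>2) = (1 - y / 2)\<^sup>2 + 3 / 4 * y\<^sup>2"
      by (simp add: power2_eq_square algebra_simps)
    then show "0 \<le> 1 - y + y\<^sup>2" by simp
  qed simp
  finally have "exp (- y) \<le> 1 - y + y\<^sup>2"
    by (simp add: exp_minus field_simps)
  then show ?thesis by (simp add: y_def)
qed

text \<open>By independence the moment generating function is a product over \<open>A\<close>;
  coordinates outside \<open>F\<close> contribute the factor 1.\<close>

lemma expectation_exp_card_Pi_pmf:
  fixes p l :: real
  assumes "finite A" "F \<subseteq> A" "0 \<le> p" "p \<le> 1"
  shows "measure_pmf.expectation (Pi_pmf A False (\<lambda>_. bernoulli_pmf p))
           (\<lambda>X. exp (l * card {e \<in> F. X e})) = (1 + p * (exp l - 1)) ^ card F"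
proof -
  have fF: "finite F" using assms finite_subset by blast
  define f where "f = (\<lambda>e b. if e \<in> F \<and> b then exp l else (1 :: real))"
  have "exp (l * card {e \<in> F. X e}) = (\<Prod>e\<in>A. f e (X e))" for X
  proof -
    have "(\<Prod>e\<in>A. f e (X e)) = (\<Prod>e\<in>{e \<in> F. X e}. exp l)"
      unfolding f_def by (rule prod.mono_neutral_cong_right) (use assms in auto)
    then show ?thesis by (simp add: exp_of_nat2_mult)
  qed
  moreover have "measure_pmf.expectation (Pi_pmf A False (\<lambda>_. bernoulli_pmf p))
           (\<lambda>X. \<Prod>e\<in>A. f e (X e)) = (\<Prod>e\<in>A. measure_pmf.expectation (bernoulli_pmf p) (f e))"
    by (rule expectation_prod_Pi_pmf) (auto simp: assms(1) f_def integrable_measure_pmf_finite)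
  ultimately have "measure_pmf.expectation (Pi_pmf A False (\<lambda>_. bernoulli_pmf p))
           (\<lambda>X. exp (l * card {e \<in> F. X e})) =
        (\<Prod>e\<in>A. measure_pmf.expectation (bernoulli_pmf p) (f e))"
    by simp
  also have "\<dots> = (\<Prod>e\<in>A. if e \<in> F then 1 + p * (exp l - 1) else 1)"
    using assms(3,4) by (intro prod.cong) (auto simp: f_def algebra_simps)
  also have "\<dots> = (\<Prod>e\<in>F. 1 + p * (exp l - 1))"
    by (rule prod.mono_neutral_cong_right) (use assms in auto)
  finally show ?thesis by simp
qed

text \<open>Markov's inequality for the exponential moment, with
  \<open>exp l - 1 \<le> l + l\<^sup>2\<close>. Positive \<open>l\<close> gives the upper tail and
  negative \<open>l\<close> the lower tail, so one statement serves both.\<close>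

lemma chernoff_Pi_pmf_bernoulli:
  fixes p l r :: real
  assumes "finite A" "F \<subseteq> A" "0 \<le> p" "p \<le> 1" "\<bar>l\<bar> \<le> 1"
  shows "measure_pmf.prob (Pi_pmf A False (\<lambda>_. bernoulli_pmf p))
           {X. l * (1 + l) * p * card F + r \<le> l * card {e \<in> F. X e}} \<le> exp (- r)"
proof -
  let ?P = "Pi_pmf A False (\<lambda>_. bernoulli_pmf p)"
  let ?c = "l * (1 + l) * p * card F + r"
  have fin: "finite (set_pmf ?P)"
    by (rule finite_subset[OF set_Pi_pmf_subset'[OF assms(1)]])
       (intro finite_PiE_dflt assms(1) finite)
  have "measure_pmf.prob ?P {X. ?c \<le> l * card {e \<in> F. X e}} =
        measure_pmf.prob ?P {X \<in> space ?P. exp ?c \<le> exp (l * card {e \<in> F. X e})}"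
    by simp
  also have "\<dots> \<le> measure_pmf.expectation ?P (\<lambda>X. exp (l * card {e \<in> F. X e})) / exp ?c"
    by (rule integral_Markov_inequality_measure[where A = UNIV])
       (auto intro: integrable_measure_pmf_finite[OF fin])
  also have "\<dots> = (1 + p * (exp l - 1)) ^ card F / exp ?c"
    using expectation_exp_card_Pi_pmf[OF assms(1-4)] by simp
  also have "\<dots> \<le> exp (card F * (p * (l + l\<^sup>2))) / exp ?c"
  proof (intro divide_right_mono)
    have "exp l - 1 \<le> l + l\<^sup>2" using exp_le_quadratic[OF assms(5)] by simp
    then have "p * (exp l - 1) \<le> p * (l + l\<^sup>2)" using assms(3) by (rule mult_left_mono)
    then have "1 + p * (exp l - 1) \<le> exp (p * (l + l\<^sup>2))"
      using exp_ge_add_one_self[of "p * (l + l\<^sup>2)"] by linarith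
    moreover have "0 \<le> 1 + p * (exp l - 1)"
    proof -
      have "1 + p * (exp l - 1) = (1 - p) + p * exp l" by (simp add: algebra_simps)
      also have "0 \<le> \<dots>" using assms(3,4) by (intro add_nonneg_nonneg) simp_all
      finally show ?thesis .
    qed
    ultimately have "(1 + p * (exp l - 1)) ^ card F \<le> exp (p * (l + l\<^sup>2)) ^ card F"
      by (rule power_mono)
    then show "(1 + p * (exp l - 1)) ^ card F \<le> exp (card F * (p * (l + l\<^sup>2)))"
      by (simp add: exp_of_nat_mult)
  qed simp
  also have "\<dots> = exp (- r)"
    by (simp add: exp_diff[symmetric] algebra_simps power2_eq_square)
  finally show ?thesis .
qed

lemma prob_all_edges_Pi_pmf:
  fixes p :: real
  assumes "finite A" "F \<subseteq> A" "0 \<le> p" "p \<le> 1"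
  shows "measure_pmf.prob (Pi_pmf A False (\<lambda>_. bernoulli_pmf p)) {X. \<forall>e\<in>F. X e} = p ^ card F"
proof -
  define B where "B = (\<lambda>e. if e \<in> F then {True} else UNIV)"
  have "{X. \<forall>e\<in>F. X e} = Pi A B"
    using assms(2) by (auto simp: B_def Pi_def split: if_splits)
  then have "measure_pmf.prob (Pi_pmf A False (\<lambda>_. bernoulli_pmf p)) {X. \<forall>e\<in>F. X e} =
     (\<Prod>e\<in>A. measure_pmf.prob (bernoulli_pmf p) (B e))"
    using assms(1) by (simp add: measure_Pi_pmf_Pi)
  also have "\<dots> = (\<Prod>e\<in>A. if e \<in> F then p else 1)"
    using assms(3,4) by (intro prod.cong) (auto simp: B_def measure_pmf_single)
  also have "\<dots> = (\<Prod>e\<in>F. p)"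
    by (rule prod.mono_neutral_cong_right) (use assms in auto)
  finally show ?thesis by simp
qed

lemma sum_Pow_power_card:
  fixes y :: "'a :: comm_semiring_1"
  assumes "finite V"
  shows "(\<Sum>A\<in>Pow V. y ^ card A) = (1 + y) ^ card V"
  using prod_add[OF assms, of "\<lambda>_. y" "\<lambda>_. 1"] by (simp add: add.commute)

subsection \<open>Sums of squares\<close>

text \<open>Comparison of a decreasing sum with an integral: \<open>y\<^sup>2\<close> is the term at
  0, the rest is the integral of (y - t)^2 over [0, M].\<close>

lemma sum_square_diff_le:
  fixes y :: real
  assumes "real M \<le> y"
  shows "(\<Sum>t\<le>M. (y - real t)\<^sup>2) \<le> y\<^sup>2 + (y ^ 3 - (y - real M) ^ 3) / 3"
  using assms
proof (induction M)
  case 0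
  then show ?case by simp
next
  case (Suc M)
  define z where "z = y - real (Suc M)"
  have z: "y - real M = z + 1" "z \<ge> 0" using Suc.prems by (simp_all add: z_def)
  have "(\<Sum>t\<le>M. (y - real t)\<^sup>2) \<le> y\<^sup>2 + (y ^ 3 - (z + 1) ^ 3) / 3"
    using Suc.IH Suc.prems unfolding z(1) by simp
  then have "(\<Sum>t\<le>Suc M. (y - real t)\<^sup>2) \<le> y\<^sup>2 + (y ^ 3 - (z + 1) ^ 3) / 3 + z\<^sup>2"
    unfolding sum.atMost_Suc z_def by (rule add_right_mono)
  also have "\<dots> \<le> y\<^sup>2 + (y ^ 3 - z ^ 3) / 3"
  proof -
    have "(z + 1) ^ 3 = z ^ 3 + 3 * z\<^sup>2 + 3 * z + 1"
      by (simp add: power2_eq_square power3_eq_cube algebra_simps)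
    then show ?thesis using z(2) by (simp only:) (simp add: field_simps)
  qed
  finally show ?case by (simp only: z_def)
qed

text \<open>Layer-cake form of the square. Subtraction on \<open>nat\<close> truncates, so the terms
  with \<open>t > d\<close> vanish and one \<open>M\<close> can serve all vertices.\<close>

lemma sum_nat_diff_eq:
  fixes d M :: nat
  assumes "d \<le> M"
  shows "d * d + d = 2 * (\<Sum>t\<le>M. d - t)"
proof -
  have "(\<Sum>t\<le>M. d - t) = (\<Sum>t\<le>d. d - t)"
    by (rule sum.mono_neutral_right) (use assms in auto)
  also have "\<dots> = (\<Sum>t\<le>d. t)"
    by (rule sum.reindex_bij_witness[of _ "\<lambda>t. d - t" "\<lambda>t. d - t"]) auto
  finally show ?thesis using gauss_sum_nat[of d] by (simp add: atMost_atLeast0)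
qed

text \<open>Since \<open>q (k m - k\<^sup>2 / 2) - k t \<le> (q m - t)\<^sup>2 / (2 q)\<close> for every \<open>k\<close>, the
  hypothesis bounds the excess of \<open>d\<close> over each threshold \<open>t\<close>; summing over \<open>t\<close> yields the
  second moment.\<close>

lemma sum_squares_le_of_subset_sums_le:
  fixes d :: "'a \<Rightarrow> nat" and q m :: real
  assumes fin: "finite V" and q: "q > 0" and m: "m \<ge> 0"
    and sub: "\<And>T. T \<subseteq> V \<Longrightarrow>
      real (\<Sum>v\<in>T. d v) \<le> q * (real (card T) * m - (real (card T))\<^sup>2 / 2)"
  shows "real (\<Sum>v\<in>V. (d v)\<^sup>2) \<le> q\<^sup>2 * m ^ 3 / 3 + q * m\<^sup>2"
proof -
  \<comment> \<open>Singletons \<open>T\<close> in the hypothesis show that no value of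
    \<open>d\<close> exceeds \<open>q * m\<close>, so thresholds up to its floor suffice.\<close>
  define y where "y = q * m"
  define M where "M = nat \<lfloor>y\<rfloor>"
  have y: "y \<ge> 0" using q m by (simp add: y_def)
  have M: "real M \<le> y" using y by (simp add: M_def)
  have dM: "d v \<le> M" if "v \<in> V" for v
  proof -
    have "real (d v) \<le> y" using sub[of "{v}"] that q by (simp add: y_def algebra_simps)
    then show ?thesis by (simp add: M_def le_nat_floor)
  qed
  have thr: "real (\<Sum>v\<in>V. d v - t) \<le> (y - real t)\<^sup>2 / (2 * q)" for t
  proof -
    define T where "T = {v \<in> V. t \<le> d v}"
    define k where "k = real (card T)"
    have "real (\<Sum>v\<in>V. d v - t) = real (\<Sum>v\<in>T. d v - t)"
      by (subst sum.mono_neutral_right[of V T]) (auto simp: T_def fin)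
    also have "\<dots> = (\<Sum>v\<in>T. real (d v) - real t)"
      unfolding of_nat_sum by (rule sum.cong) (auto simp: T_def of_nat_diff)
    also have "\<dots> = real (\<Sum>v\<in>T. d v) - k * real t"
      by (simp add: sum_subtractf k_def)
    also have "\<dots> \<le> q * (k * m - k\<^sup>2 / 2) - k * real t"
      using sub[of T] by (simp add: T_def k_def)
    also have "\<dots> = (y - real t)\<^sup>2 / (2 * q) - (y - real t - q * k)\<^sup>2 / (2 * q)"
      using q by (simp add: y_def power2_eq_square field_simps)
    also have "\<dots> \<le> (y - real t)\<^sup>2 / (2 * q)" using q by simp
    finally show ?thesis .
  qed
  have "(\<Sum>v\<in>V. (d v)\<^sup>2) \<le> (\<Sum>v\<in>V. 2 * (\<Sum>t\<le>M. d v - t))"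
    using dM by (intro sum_mono) (simp add: power2_eq_square flip: sum_nat_diff_eq)
  also have "\<dots> = (\<Sum>t\<le>M. 2 * (\<Sum>v\<in>V. d v - t))"
    unfolding sum_distrib_left by (rule sum.swap)
  finally have "real (\<Sum>v\<in>V. (d v)\<^sup>2) \<le> real (\<Sum>t\<le>M. 2 * (\<Sum>v\<in>V. d v - t))"
    by (simp only: of_nat_le_iff)
  also have "\<dots> = (\<Sum>t\<le>M. 2 * real (\<Sum>v\<in>V. d v - t))"
    by simp
  also have "\<dots> \<le> (\<Sum>t\<le>M. (y - real t)\<^sup>2 / q)"
    using thr q by (intro sum_mono) (simp add: field_simps)
  also have "\<dots> = (\<Sum>t\<le>M. (y - real t)\<^sup>2) / q"
    by (simp add: sum_divide_distrib)
  also have "\<dots> \<le> (y\<^sup>2 + y ^ 3 / 3) / q"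
  proof (rule divide_right_mono)
    have "0 \<le> (y - real M) ^ 3" using M by simp
    then have "y\<^sup>2 + (y ^ 3 - (y - real M) ^ 3) / 3 \<le> y\<^sup>2 + y ^ 3 / 3"
      by (intro add_left_mono divide_right_mono) simp_all
    then show "(\<Sum>t\<le>M. (y - real t)\<^sup>2) \<le> y\<^sup>2 + y ^ 3 / 3"
      by (rule order_trans[OF sum_square_diff_le[OF M]])
  qed (use q in simp)
  also have "\<dots> = q\<^sup>2 * m ^ 3 / 3 + q * m\<^sup>2"
    using q by (simp add: y_def add_divide_distrib power2_eq_square power3_eq_cube)
  finally show ?thesis .
qed

subsection \<open>Digraphs without Seymour vertex\<close>

text \<open>\<open>B\<close> is the second out-layer. A vertex reached by two arcs from
  \<open>u\<close> differs from \<open>u\<close> by antisymmetry; if it is no out-neighbour of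
  \<open>u\<close>, the two arcs form a shortest path. Path lengths are thereby replaced by relation
  images.\<close>

lemma not_seymour_vertexE:
  assumes "pair_digraph D" "antisym (parcs D)" "u \<in> pverts D" "\<not> seymour_vertex (with_proj D) u"
  obtains B where "B \<subseteq> pverts D" "card B < card (parcs D `` {u})"
    "parcs D `` (parcs D `` {u}) \<subseteq> parcs D `` {u} \<union> B"
proof
  interpret pair_digraph D by fact
  let ?B = "out_layer (with_proj D) 2 u"
  have path: "pre_digraph.apath (with_proj D) x q y \<longleftrightarrow>
      x \<in> pverts D \<and> set q \<subseteq> parcs D \<and> pcas x q y \<and> distinct (pawalk_verts x q)" for x q y
    by (auto simp: pre_digraph.apath_def pre_digraph.awalk_def cas_with_proj_eq
        awalk_verts_with_proj_eq)
  have loop: "(x, x) \<notin> parcs D" for x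
    using pair_no_loops[of "(x, x)"] by auto
  have vert: "x \<in> pverts D" "y \<in> pverts D" if "(x, y) \<in> parcs D" for x y
    using arc_fst_in_verts[OF that] arc_snd_in_verts[OF that] by auto
  show "?B \<subseteq> pverts D"
  proof
    fix v assume "v \<in> ?B"
    then obtain q where q: "pre_digraph.apath (with_proj D) u q v" "length q = 2"
      by (auto simp: out_layer_def shortest_path_def is_arg_min_def)
    then obtain e f where "q = [e, f]" by (auto simp: numeral_2_eq_2 length_Suc_conv)
    then show "v \<in> pverts D" using q(1) arc_snd_in_verts[of f] by (auto simp: path)
  qed
  have "out_layer (with_proj D) 1 u \<subseteq> parcs D `` {u}"
  proof
    fix v assume "v \<in> out_layer (with_proj D) 1 u"
    then obtain q where q: "pre_digraph.apath (with_proj D) u q v" "length q = 1"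
      by (auto simp: out_layer_def shortest_path_def is_arg_min_def)
    then obtain e where "q = [e]" by (auto simp: length_Suc_conv)
    then show "v \<in> parcs D `` {u}" using q(1) by (cases e) (auto simp: path)
  qed
  moreover have "finite (parcs D `` {u})"
    using pair_finite_arcs by (rule finite_Image)
  ultimately have "card (out_layer (with_proj D) 1 u) \<le> card (parcs D `` {u})"
    by (metis card_mono)
  then show "card ?B < card (parcs D `` {u})"
    using assms(3,4) by (simp add: seymour_vertex_def)
  show "parcs D `` (parcs D `` {u}) \<subseteq> parcs D `` {u} \<union> ?B"
  proof
    fix x assume "x \<in> parcs D `` (parcs D `` {u})"
    then obtain w where w: "(u, w) \<in> parcs D" "(w, x) \<in> parcs D" by auto
    show "x \<in> parcs D `` {u} \<union> ?B"
    proof (cases "(u, x) \<in> parcs D")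
      case False
      have "u \<noteq> x" using w assms(2) loop by (metis antisymD)
      have "shortest_path (with_proj D) u [(u, w), (w, x)] x"
        unfolding shortest_path_def is_arg_min_def
      proof (intro conjI notI)
        show "pre_digraph.apath (with_proj D) u [(u, w), (w, x)] x"
          using w vert loop \<open>u \<noteq> x\<close> by (auto simp: path)
        assume "\<exists>q. pre_digraph.apath (with_proj D) u q x \<and> length q < length [(u, w), (w, x)]"
        then obtain q where q: "pre_digraph.apath (with_proj D) u q x" "length q < 2" by auto
        then consider "q = []" | e where "q = [e]"
          by (cases q) (auto simp: length_Suc_conv)
        then show False
          by cases (use q(1) \<open>u \<noteq> x\<close> False in \<open>auto simp: path\<close>)
      qed
      then have "x \<in> ?B" by (auto simp: out_layer_def)
      then show ?thesis by simp
    qed auto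
  qed
qed

lemma diamond_of_no_seymour:
  fixes R :: "'a rel"
  assumes "finite V" "V \<noteq> {}" "R \<subseteq> V \<times> V" "antisym R" "irrefl R"
    and no: "\<And>u. u \<in> V \<Longrightarrow> \<exists>B. finite B \<and> card B < card (R `` {u}) \<and>
                 R `` (R `` {u}) \<subseteq> R `` {u} \<union> B"
  obtains u x y z where "distinct [u, x, y, z]"
    "(u, x) \<in> R" "(u, y) \<in> R" "(u, z) \<in> R" "(x, y) \<in> R" "(y, z) \<in> R"
proof -
  define u where "u = arg_min_on (\<lambda>u. card (R `` {u})) V"
  have u: "u \<in> V" "\<And>w. w \<in> V \<Longrightarrow> card (R `` {u}) \<le> card (R `` {w})"
    unfolding u_def using arg_min_if_finite(1)[OF assms(1,2)] arg_min_least[OF assms(1,2)] by auto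
  obtain B where B: "finite B" "card B < card (R `` {u})" "R `` (R `` {u}) \<subseteq> R `` {u} \<union> B"
    using no[OF u(1)] by blast
  \<comment> \<open>Otherwise all out-neighbours of \<open>w\<close> lie in \<open>B\<close>, and
    \<open>w\<close> has smaller out-degree than the minimum.\<close>
  have step: "\<exists>x. (u, x) \<in> R \<and> (w, x) \<in> R" if w: "(u, w) \<in> R" for w
  proof (rule ccontr)
    assume "\<not> ?thesis"
    then have "R `` {w} \<subseteq> B" using B(3) w by blast
    then have "card (R `` {w}) \<le> card B" using B(1) by (rule card_mono[rotated])
    moreover have "w \<in> V" using w assms(3) by auto
    ultimately show False using u(2)[of w] B(2) by simp
  qed
  have "R `` {u} \<noteq> {}" using B(2) by auto
  then obtain x where x: "(u, x) \<in> R" by auto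
  obtain y where y: "(u, y) \<in> R" "(x, y) \<in> R" using step[OF x] by auto
  obtain z where z: "(u, z) \<in> R" "(y, z) \<in> R" using step[OF y(1)] by auto
  have ne: "a \<noteq> b" if "(a, b) \<in> R" for a b using that assms(5) by (auto simp: irrefl_def)
  \<comment> \<open>If \<open>z\<close> were \<open>x\<close>, the arcs between \<open>x\<close> and
    \<open>y\<close> would form a directed 2-cycle.\<close>
  have "x \<noteq> z" using y z assms(4) ne by (metis antisymD)
  then show ?thesis using that[of u x y z] x y z ne by auto
qed

text \<open>Double counting of arcs. With \<open>f\<close> constant 1 it equates the sums of in- and
  out-degrees; with \<open>f\<close> the out-degree it counts the arcs leaving the
  out-neighbourhoods.\<close>

lemma sum_Image_swap:
  fixes f :: "'a \<Rightarrow> nat"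
  assumes "finite V" "R \<subseteq> V \<times> V"
  shows "(\<Sum>v\<in>V. \<Sum>w\<in>R `` {v}. f w) = (\<Sum>w\<in>V. card (R\<inverse> `` {w}) * f w)"
proof -
  have "(\<Sum>v\<in>V. \<Sum>w\<in>R `` {v}. f w) = (\<Sum>v\<in>V. \<Sum>w | w \<in> V \<and> (v, w) \<in> R. f w)"
    using assms(2) by (intro sum.cong) auto
  also have "\<dots> = (\<Sum>w\<in>V. \<Sum>v | v \<in> V \<and> (v, w) \<in> R. f w)"
    by (rule sum.swap_restrict[OF assms(1,1)])
  also have "\<dots> = (\<Sum>w\<in>V. card (R\<inverse> `` {w}) * f w)"
  proof (rule sum.cong)
    fix w
    have "{v. v \<in> V \<and> (v, w) \<in> R} = R\<inverse> `` {w}" using assms(2) by auto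
    then show "(\<Sum>v | v \<in> V \<and> (v, w) \<in> R. f w) = card (R\<inverse> `` {w}) * f w" by simp
  qed simp
  finally show ?thesis .
qed

text \<open>The deterministic core of the dense regime. \<open>out\<close> bounds the second moment
  of the out-degrees from above, while \<open>deg\<close> and \<open>nbr\<close> bound it from below
  in terms of the first moment; the two bounds are incompatible.\<close>

lemma degree_conditions_contradiction:
  fixes V :: "'a set" and R :: "'a rel" and p :: real
  defines "d \<equiv> \<lambda>v. card (R `` {v})" and "n \<equiv> real (card V)" and "\<epsilon> \<equiv> 1 / 1000 :: real"
  assumes fin: "finite V" and RV: "R \<subseteq> V \<times> V" and p: "0 < p" "p \<le> 1 / 4"
    and np: "n * p \<ge> 1000"
    and deg: "\<And>v. v \<in> V \<Longrightarrow> (1 - 3 * \<epsilon>) * (n * p) \<le> real (d v + card (R\<inverse> `` {v}))"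
    and out: "\<And>T. T \<subseteq> V \<Longrightarrow> real (\<Sum>v\<in>T. d v) \<le>
        (1 + \<epsilon>) * p * (real (card T) * n - (real (card T))\<^sup>2 / 2) + \<epsilon> * (n * p) * card T"
    and nbr: "\<And>v. v \<in> V \<Longrightarrow> real (\<Sum>w\<in>R `` {v}. d w) \<le>
        (1 + \<epsilon>) * p * (3 / 2 * (real (d v))\<^sup>2) + \<epsilon> * (n * p) * d v"
  shows False
proof -
  define D1 where "D1 = real (\<Sum>v\<in>V. d v)"
  define D2 where "D2 = real (\<Sum>v\<in>V. (d v)\<^sup>2)"
  have n: "n > 0" using np p by (metis less_le_trans zero_less_mult_pos2 zero_less_numeral)
  have pn: "p\<^sup>2 * n ^ 3 > 0" using p n by simp
  have "D2 \<le> ((1 + \<epsilon>) * p)\<^sup>2 * ((1 + \<epsilon>) * n) ^ 3 / 3 + (1 + \<epsilon>) * p * ((1 + \<epsilon>) * n)\<^sup>2"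
    unfolding D2_def
  proof (rule sum_squares_le_of_subset_sums_le[OF fin])
    show "(1 + \<epsilon>) * p > 0" "(1 + \<epsilon>) * n \<ge> 0" using p n by (simp_all add: \<epsilon>_def)
    fix T assume T: "T \<subseteq> V"
    \<comment> \<open>The slack linear in \<open>card T\<close> is absorbed by taking
      \<open>m = (1 + \<epsilon>) * n\<close> in place of \<open>n\<close>.\<close>
    have "\<epsilon> * (n * p) * card T \<le> (1 + \<epsilon>) * p * (card T * (\<epsilon> * n))"
      using p n by (simp add: \<epsilon>_def field_simps)
    then show "real (\<Sum>v\<in>T. d v) \<le>
        (1 + \<epsilon>) * p * (real (card T) * ((1 + \<epsilon>) * n) - (real (card T))\<^sup>2 / 2)"
      using out[OF T] by (simp add: algebra_simps)
  qed
  also have "\<dots> = (1 + \<epsilon>) ^ 5 / 3 * (p\<^sup>2 * n ^ 3) + (1 + \<epsilon>) ^ 3 * (p * n\<^sup>2)"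
    by (simp add: power_mult_distrib eval_nat_numeral algebra_simps)
  \<comment> \<open>Here \<open>n * p \<ge> 1 / \<epsilon>\<close> makes the discretization error
    negligible; the coefficient becomes about 0.336, rounded up to 0.34.\<close>
  also have "p * n\<^sup>2 \<le> \<epsilon> * (p\<^sup>2 * n ^ 3)"
  proof -
    have "1000 * (p * n\<^sup>2) \<le> (n * p) * (p * n\<^sup>2)"
      using np p n by (intro mult_right_mono) auto
    then show ?thesis by (simp add: \<epsilon>_def power2_eq_square power3_eq_cube algebra_simps)
  qed
  finally have D2: "D2 \<le> 34 / 100 * (p\<^sup>2 * n ^ 3)"
    using pn by (simp add: \<epsilon>_def eval_nat_numeral algebra_simps)
  have "(\<Sum>v\<in>V. (1 - 3 * \<epsilon>) * (n * p)) \<le> (\<Sum>v\<in>V. real (d v + card (R\<inverse> `` {v})))"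
    by (rule sum_mono) (rule deg)
  also have "\<dots> = 2 * D1"
    using sum_Image_swap[OF fin RV, of "\<lambda>_. 1"] by (simp add: D1_def d_def sum.distrib flip: of_nat_sum)
  finally have D1: "(1 - 3 * \<epsilon>) * (n\<^sup>2 * p) \<le> 2 * D1"
    by (simp add: n_def power2_eq_square algebra_simps)
  \<comment> \<open>Each out-degree is weighted by the total degree: the out-part gives
    \<open>D2\<close>, and the in-part becomes the sums bounded by \<open>nbr\<close>.\<close>
  have "(1 - 3 * \<epsilon>) * (n * p) * D1 = (\<Sum>v\<in>V. (1 - 3 * \<epsilon>) * (n * p) * d v)"
    by (simp add: D1_def sum_distrib_left)
  also have "\<dots> \<le> (\<Sum>v\<in>V. real (d v + card (R\<inverse> `` {v})) * d v)"
    by (intro sum_mono mult_right_mono deg) auto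
  also have "\<dots> = D2 + real (\<Sum>v\<in>V. card (R\<inverse> `` {v}) * d v)"
    by (simp add: D2_def power2_eq_square algebra_simps sum.distrib)
  also have "real (\<Sum>v\<in>V. card (R\<inverse> `` {v}) * d v) = (\<Sum>v\<in>V. real (\<Sum>w\<in>R `` {v}. d w))"
    by (simp only: sum_Image_swap[OF fin RV, symmetric] of_nat_sum)
  also have "\<dots> \<le> (\<Sum>v\<in>V. (1 + \<epsilon>) * p * (3 / 2 * (real (d v))\<^sup>2) + \<epsilon> * (n * p) * d v)"
    by (intro sum_mono nbr)
  also have "\<dots> = (1 + \<epsilon>) * p * (3 / 2 * D2) + \<epsilon> * (n * p) * D1"
    by (simp add: D1_def D2_def sum.distrib sum_distrib_left)
  finally have "(1 - 4 * \<epsilon>) * (n * p) * D1 \<le> (1 + (1 + \<epsilon>) * p * (3 / 2)) * D2"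
    by (simp add: algebra_simps)
  \<comment> \<open>For \<open>p \<le> 1 / 4\<close> the factor is at most 1 + 1.001 * 3/8 =
    1.375375.\<close>
  also have "\<dots> \<le> 138 / 100 * D2"
    using p by (intro mult_right_mono) (auto simp: \<epsilon>_def D2_def intro: sum_nonneg)
  also have "\<dots> \<le> 138 / 100 * (34 / 100 * (p\<^sup>2 * n ^ 3))"
    by (intro mult_left_mono D2) simp
  finally have le: "(1 - 4 * \<epsilon>) * (n * p) * D1 \<le> 46920 / 100000 * (p\<^sup>2 * n ^ 3)" by simp
  \<comment> \<open>Inserting the lower bound on \<open>D1\<close> would require 0.996 * 0.997 =
    0.993012 to be at most 2 * 1.38 * 0.34 = 0.9384.\<close>
  have "(1 - 4 * \<epsilon>) * (n * p) * ((1 - 3 * \<epsilon>) * (n\<^sup>2 * p)) \<le> (1 - 4 * \<epsilon>) * (n * p) * (2 * D1)"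
    using p n by (intro mult_left_mono D1) (auto simp: \<epsilon>_def)
  with le have "(1 - 4 * \<epsilon>) * (1 - 3 * \<epsilon>) * (p\<^sup>2 * n ^ 3) \<le> 93840 / 100000 * (p\<^sup>2 * n ^ 3)"
    by (simp add: power2_eq_square power3_eq_cube algebra_simps)
  with pn show False by (simp add: \<epsilon>_def mult.commute)
qed

subsection \<open>Edge distribution of the random graph\<close>

text \<open>A pair inside \<open>A\<close> is counted once although both ends lie in
  \<open>A\<close>, matching the single arc that an orientation puts on it.\<close>

definition touching :: "'a set \<Rightarrow> 'a set \<Rightarrow> 'a set set" where
  "touching A C = {e. e \<subseteq> C \<and> card e = 2 \<and> e \<inter> A \<noteq> {}}"

lemma finite_touching: "finite C \<Longrightarrow> finite (touching A C)"
  by (rule finite_subset[of _ "Pow C"]) (auto simp: touching_def)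

lemma touching_subset_pairs_upto: "C \<subseteq> {1..n} \<Longrightarrow> touching A C \<subseteq> pairs_upto n"
  by (auto simp: touching_def pairs_upto_def)

lemma real_choose_two: "real (m choose 2) = real m * (real m - 1) / 2"
  by (cases m) (simp_all add: choose_two real_of_nat_div algebra_simps)

text \<open>The pairs in \<open>C\<close> that avoid \<open>A\<close> are the pairs in
  \<open>C - A\<close>; subtract them from all pairs.\<close>

lemma card_touching:
  assumes "finite C" "A \<subseteq> C"
  shows "real (card (touching A C)) =
    real (card A) * real (card C) - (real (card A))\<^sup>2 / 2 - real (card A) / 2"
proof -
  have fin: "finite (C - A)" "finite A" using assms by (auto intro: finite_subset)
  have "{e. e \<subseteq> C \<and> card e = 2} = touching A C \<union> {e. e \<subseteq> C - A \<and> card e = 2}"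
    by (auto simp: touching_def)
  then have "card {e. e \<subseteq> C \<and> card e = 2} = card (touching A C) + card {e. e \<subseteq> C - A \<and> card e = 2}"
    using assms fin
    by (subst card_Un_disjoint[symmetric])
       (auto simp: touching_def intro: finite_subset[of _ "Pow C"])
  then have "card C choose 2 = card (touching A C) + ((card C - card A) choose 2)"
    using n_subsets[OF assms(1), of 2] n_subsets[OF fin(1), of 2] assms fin
    by (simp add: card_Diff_subset)
  then have "real (card (touching A C)) = real (card C choose 2) - real ((card C - card A) choose 2)"
    by simp
  also have "real (card C - card A) = real (card C) - real (card A)"
    using card_mono[OF assms] by (simp add: of_nat_diff)
  then have "real (card C choose 2) - real ((card C - card A) choose 2) =
     real (card A) * real (card C) - (real (card A))\<^sup>2 / 2 - real (card A) / 2"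
    by (simp add: real_choose_two power2_eq_square field_simps)
  finally show ?thesis .
qed

text \<open>The case \<open>C = {1..n}\<close> controls sums of out-degrees over arbitrary \<open>A\<close>; the case
  \<open>card C \<le> 2 * card A\<close> is applied with \<open>A = N\<^sup>1(v)\<close> and \<open>C = N\<^sup>1(v) \<union> N\<^sup>2(v)\<close>.\<close>

definition edge_regular :: "nat \<Rightarrow> real \<Rightarrow> real \<Rightarrow> (nat set \<Rightarrow> bool) \<Rightarrow> bool" where
  "edge_regular n p \<epsilon> X \<longleftrightarrow>
     (\<forall>v\<in>{1..n}. (1 - \<epsilon>) * p * real (card (touching {v} {1..n})) - \<epsilon> * real n * p
        < real (card {e \<in> touching {v} {1..n}. X e})) \<and>
     (\<forall>A C. A \<noteq> {} \<and> A \<subseteq> C \<and> C \<subseteq> {1..n} \<and> (C = {1..n} \<or> card C \<le> 2 * card A) \<longrightarrow>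
        real (card {e \<in> touching A C. X e})
          < (1 + \<epsilon>) * p * real (card (touching A C)) + \<epsilon> * real n * p * real (card A))"

lemma sum_power_card_nonempty:
  fixes y :: real
  assumes "finite V"
  shows "(\<Sum>A\<in>Pow V - {{}}. y ^ card A) = (1 + y) ^ card V - 1"
  using assms by (simp add: sum_diff1 sum_Pow_power_card)

text \<open>Union bound over Chernoff failures at vertices, at sets \<open>A\<close> with
  \<open>C = {1..n}\<close>, and at pairs \<open>A\<close>, \<open>C\<close>. The division by 3 in
  \<open>y\<close> makes a failure at \<open>A\<close> cost \<open>y ^ (3 * card A)\<close>: one
  third pays for the choice of \<open>A\<close>, the other two for the choice of
  \<open>C\<close>.\<close>

lemma prob_not_edge_regular:
  fixes n :: nat and p \<epsilon> y :: real
  assumes p: "0 \<le> p" "p \<le> 1" and \<epsilon>: "0 < \<epsilon>" "\<epsilon> \<le> 1"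
  defines "P \<equiv> Pi_pmf (pairs_upto n) False (\<lambda>_. bernoulli_pmf p)"
    and "y \<equiv> exp (- (\<epsilon>\<^sup>2 * n * p / 3))"
  shows "measure_pmf.prob P {X. \<not> edge_regular n p \<epsilon> X}
     \<le> n * y ^ 3 + ((1 + y) ^ n - 1) + ((1 + y) ^ n - 1)\<^sup>2"
proof -
  let ?V = "{1..n}"
  let ?prob = "measure_pmf.prob P"
  define I where "I = Pow ?V - {{}}"
  define J where "J = {(A, C). A \<in> I \<and> A \<subseteq> C \<and> C \<subseteq> ?V \<and> card C \<le> 2 * card A}"
  define L where "L = (\<lambda>v. {X. card {e \<in> touching {v} ?V. X e}
      \<le> (1 - \<epsilon>) * p * card (touching {v} ?V) - \<epsilon> * n * p})"
  define U where "U = (\<lambda>(A :: nat set) C. {X. (1 + \<epsilon>) * p * card (touching A C) + \<epsilon> * n * p * card A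
      \<le> card {e \<in> touching A C. X e}})"
  have y: "0 < y" "y \<le> 1" using p \<epsilon> by (simp_all add: y_def)
  have y3: "y ^ (3 * k) = exp (- (\<epsilon>\<^sup>2 * n * p * k))" for k
    by (simp add: y_def flip: exp_of_nat_mult)
  have finI: "finite I" by (simp add: I_def)
  have finJ: "finite J"
    by (rule finite_subset[of _ "Pow ?V \<times> Pow ?V"]) (auto simp: I_def J_def)
  have L: "?prob (L v) \<le> y ^ 3" if "v \<in> ?V" for v
  proof -
    \<comment> \<open>Multiplication by \<open>- \<epsilon>\<close> turns the lower tail into the
      Chernoff event with \<open>l = - \<epsilon>\<close>.\<close>
    have "L v = {X. - \<epsilon> * (1 + - \<epsilon>) * p * card (touching {v} ?V) + \<epsilon>\<^sup>2 * n * p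
        \<le> - \<epsilon> * card {e \<in> touching {v} ?V. X e}}"
    proof -
      have "a \<le> (1 - \<epsilon>) * p * b - \<epsilon> * n * p \<longleftrightarrow> - \<epsilon> * (1 + - \<epsilon>) * p * b + \<epsilon>\<^sup>2 * n * p \<le> - \<epsilon> * a"
        for a b :: real
      proof -
        have "a \<le> (1 - \<epsilon>) * p * b - \<epsilon> * n * p \<longleftrightarrow> \<epsilon> * a \<le> \<epsilon> * ((1 - \<epsilon>) * p * b - \<epsilon> * n * p)"
          using \<epsilon> by simp
        then show ?thesis by (simp add: power2_eq_square algebra_simps)
      qed
      then show ?thesis by (simp add: L_def)
    qed
    also have "?prob \<dots> \<le> exp (- (\<epsilon>\<^sup>2 * n * p))"
      unfolding P_def
      by (rule chernoff_Pi_pmf_bernoulli)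
         (use p \<epsilon> finite_pairs_upto touching_subset_pairs_upto[of ?V n] in auto)
    finally show ?thesis using y3[of 1] by simp
  qed
  have U: "?prob (U A C) \<le> y ^ (3 * card A)" if "C \<subseteq> ?V" for A C
  proof -
    have "U A C = {X. \<epsilon> * (1 + \<epsilon>) * p * card (touching A C) + \<epsilon>\<^sup>2 * n * p * card A
        \<le> \<epsilon> * card {e \<in> touching A C. X e}}"
    proof -
      have "(1 + \<epsilon>) * p * b + \<epsilon> * n * p * c \<le> a \<longleftrightarrow> \<epsilon> * (1 + \<epsilon>) * p * b + \<epsilon>\<^sup>2 * n * p * c \<le> \<epsilon> * a"
        for a b c :: real
      proof -
        have "(1 + \<epsilon>) * p * b + \<epsilon> * n * p * c \<le> a \<longleftrightarrow> \<epsilon> * ((1 + \<epsilon>) * p * b + \<epsilon> * n * p * c) \<le> \<epsilon> * a"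
          using \<epsilon> by simp
        then show ?thesis by (simp add: power2_eq_square algebra_simps)
      qed
      then show ?thesis by (simp add: U_def)
    qed
    also have "?prob \<dots> \<le> exp (- (\<epsilon>\<^sup>2 * n * p * card A))"
      unfolding P_def
      by (rule chernoff_Pi_pmf_bernoulli)
         (use p \<epsilon> finite_pairs_upto touching_subset_pairs_upto[OF that] in auto)
    finally show ?thesis using y3 by simp
  qed
  have bad: "{X. \<not> edge_regular n p \<epsilon> X} \<subseteq> (\<Union>v\<in>?V. L v) \<union> (\<Union>A\<in>I. U A ?V) \<union> (\<Union>(A, C)\<in>J. U A C)"
  proof
    fix X assume "X \<in> {X. \<not> edge_regular n p \<epsilon> X}"
    then consider v where "v \<in> ?V" "X \<in> L v"
      | A C where "A \<noteq> {}" "A \<subseteq> C" "C \<subseteq> ?V" "C = ?V \<or> card C \<le> 2 * card A" "X \<in> U A C"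
      unfolding edge_regular_def L_def U_def by (auto simp: not_less)
    then show "X \<in> (\<Union>v\<in>?V. L v) \<union> (\<Union>A\<in>I. U A ?V) \<union> (\<Union>(A, C)\<in>J. U A C)"
    proof cases
      case 1
      then show ?thesis by blast
    next
      case 2
      then have "A \<in> I" by (auto simp: I_def)
      then show ?thesis using 2 by (auto simp: J_def)
    qed
  qed
  have "?prob (\<Union>v\<in>?V. L v) \<le> (\<Sum>v\<in>?V. ?prob (L v))"
    by (rule measure_UNION_le) auto
  also have "\<dots> \<le> (\<Sum>v\<in>?V. y ^ 3)" by (rule sum_mono) (rule L)
  finally have 1: "?prob (\<Union>v\<in>?V. L v) \<le> n * y ^ 3" by simp
  have "?prob (\<Union>A\<in>I. U A ?V) \<le> (\<Sum>A\<in>I. ?prob (U A ?V))"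
    by (rule measure_UNION_le) (use finI in auto)
  also have "\<dots> \<le> (\<Sum>A\<in>I. y ^ (3 * card A))" by (rule sum_mono) (rule U, simp)
  also have "\<dots> \<le> (\<Sum>A\<in>I. y ^ card A)" using y by (intro sum_mono power_decreasing) auto
  also have "\<dots> = (1 + y) ^ n - 1" by (simp add: I_def sum_power_card_nonempty)
  finally have 2: "?prob (\<Union>A\<in>I. U A ?V) \<le> (1 + y) ^ n - 1" .
  have "?prob (\<Union>(A, C)\<in>J. U A C) \<le> (\<Sum>z\<in>J. ?prob (case z of (A, C) \<Rightarrow> U A C))"
    by (rule measure_UNION_le) (use finJ in auto)
  also have "\<dots> \<le> (\<Sum>(A, C)\<in>J. y ^ card A * y ^ card C)"
  proof (rule sum_mono)
    fix z assume "z \<in> J"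
    then obtain A C where z: "z = (A, C)" "C \<subseteq> ?V" "card C \<le> 2 * card A"
      by (auto simp: J_def)
    have "?prob (U A C) \<le> y ^ (3 * card A)" by (rule U[OF z(2)])
    also have "\<dots> \<le> y ^ (card A + card C)" using y z(3) by (intro power_decreasing) auto
    finally show "?prob (case z of (A, C) \<Rightarrow> U A C) \<le> (case z of (A, C) \<Rightarrow> y ^ card A * y ^ card C)"
      by (simp add: z(1) power_add)
  qed
  \<comment> \<open>Dropping the constraints between \<open>A\<close> and \<open>C\<close> lets the
    sum factorize; \<open>C\<close> is nonempty because it contains \<open>A\<close>.\<close>
  also have "\<dots> \<le> (\<Sum>(A, C)\<in>I \<times> I. y ^ card A * y ^ card C)"
    using y finI by (intro sum_mono2) (auto simp: I_def J_def)
  also have "\<dots> = ((1 + y) ^ n - 1)\<^sup>2"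
    by (simp add: power2_eq_square I_def sum_power_card_nonempty flip: sum.cartesian_product sum_product)
  finally have 3: "?prob (\<Union>(A, C)\<in>J. U A C) \<le> ((1 + y) ^ n - 1)\<^sup>2" .
  have "?prob {X. \<not> edge_regular n p \<epsilon> X}
      \<le> ?prob ((\<Union>v\<in>?V. L v) \<union> (\<Union>A\<in>I. U A ?V) \<union> (\<Union>(A, C)\<in>J. U A C))"
    by (rule measure_pmf.finite_measure_mono[OF bad]) simp
  also have "\<dots> \<le> ?prob (\<Union>v\<in>?V. L v) + ?prob (\<Union>A\<in>I. U A ?V) + ?prob (\<Union>(A, C)\<in>J. U A C)"
    by (intro order_trans[OF measure_Un_le] add_right_mono) auto
  finally show ?thesis using 1 2 3 by linarith
qed

subsection \<open>Orientations of the random graph\<close>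

definition edge_graph :: "nat \<Rightarrow> (nat set \<Rightarrow> bool) \<Rightarrow> nat pair_pre_digraph" where
  "edge_graph n X = \<lparr>pverts = {1..n}, parcs = {(u, v). X {u, v}}\<rparr>"

text \<open>Translates the situation into a relation \<open>R\<close>, the arc set of
  \<open>D\<close>; both regimes argue only about \<open>R\<close>.\<close>

lemma orientation_without_seymour_vertex:
  assumes X: "X \<in> set_pmf (Pi_pmf (pairs_upto n) False (\<lambda>_. bernoulli_pmf p))"
    and D: "orientation (edge_graph n X) D" and no: "\<nexists>u. seymour_vertex (with_proj D) u"
  obtains R where "R \<subseteq> {1..n} \<times> {1..n}" "antisym R" "irrefl R"
    "\<And>u v. X {u, v} \<longleftrightarrow> (u, v) \<in> R \<or> (v, u) \<in> R"
    "\<And>u. u \<in> {1..n} \<Longrightarrow> \<exists>B \<subseteq> {1..n}. card B < card (R `` {u}) \<and> R `` (R `` {u}) \<subseteq> R `` {u} \<union> B"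
proof
  let ?R = "parcs D"
  have "edge_graph n X \<in> set_pmf (binomial_random_graph n p)"
    using X by (auto simp: binomial_random_graph_def edge_graph_def)
  then have G: "pair_graph (edge_graph n X)" by (rule pair_graph_binomial_random_graph)
  interpret D: pair_digraph D by (rule orientation_oriented(1)[OF G D])
  have V: "pverts D = {1..n}" using D by (simp add: orientation_def edge_graph_def)
  show anti: "antisym ?R" by (rule orientation_oriented(2)[OF G D])
  show "?R \<subseteq> {1..n} \<times> {1..n}"
    using D.arc_fst_in_verts D.arc_snd_in_verts V by force
  show "irrefl ?R" using D.pair_no_loops by (force simp: irrefl_def)
  have arc: "X {a, b}" if "(a, b) \<in> ?R" for a b
    using D that by (auto simp: orientation_def edge_graph_def)
  have edge: "(a, b) \<in> ?R \<longleftrightarrow> (b, a) \<notin> ?R" if "X {a, b}" for a b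
    using D that by (auto simp: orientation_def edge_graph_def)
  show "X {u, v} \<longleftrightarrow> (u, v) \<in> ?R \<or> (v, u) \<in> ?R" for u v
    using arc[of u v] arc[of v u] edge[of u v] insert_commute[of u v "{}"] by metis
  show "\<exists>B \<subseteq> {1..n}. card B < card (?R `` {u}) \<and> ?R `` (?R `` {u}) \<subseteq> ?R `` {u} \<union> B"
    if "u \<in> {1..n}" for u
    by (rule not_seymour_vertexE[OF D.pair_digraph_axioms anti, of u]) (use that no V in auto)
qed

section \<open>The dense regime: edge regularity forces a Seymour vertex\<close>

lemma card_arcs_le_edges:
  assumes "antisym R" "Q \<subseteq> R" "finite F" "\<And>u v. (u, v) \<in> Q \<Longrightarrow> {u, v} \<in> F"
  shows "card Q \<le> card F"
proof (rule card_inj_on_le[where f = "\<lambda>(u, v). {u, v}"])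
  \<comment> \<open>Two different arcs over the same pair would be opposite, contrary to
    antisymmetry.\<close>
  show "inj_on (\<lambda>(u, v). {u, v}) Q"
    by (auto simp: inj_on_def doubleton_eq_iff dest!: subsetD[OF assms(2)] dest: antisymD[OF assms(1)])
qed (use assms in auto)

lemma edge_regular_imp_seymour_vertex:
  fixes n :: nat and p :: real
  assumes X: "X \<in> set_pmf (Pi_pmf (pairs_upto n) False (\<lambda>_. bernoulli_pmf p))"
    and reg: "edge_regular n p (1 / 1000) X"
    and p: "0 < p" "p \<le> 1 / 4" and np: "n * p \<ge> 1000"
    and D: "orientation (edge_graph n X) D"
  shows "\<exists>u. seymour_vertex (with_proj D) u"
proof (rule ccontr)
  assume no: "\<nexists>u. seymour_vertex (with_proj D) u"
  define \<epsilon> :: real where "\<epsilon> = 1 / 1000"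
  let ?V = "{1..n}"
  obtain R where R: "R \<subseteq> ?V \<times> ?V" "antisym R" "irrefl R"
    and XR: "\<And>u v. X {u, v} \<longleftrightarrow> (u, v) \<in> R \<or> (v, u) \<in> R"
    and B: "\<And>u. u \<in> ?V \<Longrightarrow>
       \<exists>B \<subseteq> ?V. card B < card (R `` {u}) \<and> R `` (R `` {u}) \<subseteq> R `` {u} \<union> B"
    using orientation_without_seymour_vertex[OF X D no] by blast
  have finR: "finite R" using R(1) by (rule finite_subset) simp
  have finN: "finite (R `` A)" "finite (R\<inverse> `` A)" for A using finR by auto
  have ne: "u \<noteq> v" if "(u, v) \<in> R" for u v using that R(3) by (auto simp: irrefl_def)
  have lower: "(1 - \<epsilon>) * p * real (card (touching {v} ?V)) - \<epsilon> * n * p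
      < card {e \<in> touching {v} ?V. X e}" if "v \<in> ?V" for v
    using reg that by (simp add: edge_regular_def \<epsilon>_def)
  have upper: "real (card {e \<in> touching A C. X e})
      < (1 + \<epsilon>) * p * real (card (touching A C)) + \<epsilon> * n * p * real (card A)"
    if "A \<noteq> {}" "A \<subseteq> C" "C \<subseteq> ?V" "C = ?V \<or> card C \<le> 2 * card A" for A C
    using conjunct2[OF reg[unfolded edge_regular_def], rule_format, of A C] that
    unfolding \<epsilon>_def by simp
  have out_sum: "real (\<Sum>v\<in>A. card (R `` {v})) \<le> real (card {e \<in> touching A C. X e})"
    if "A \<subseteq> C" "R `` A \<subseteq> C" "finite C" for A C
  proof -
    have "finite A" using that by (auto intro: finite_subset)
    then have "(\<Sum>v\<in>A. card (R `` {v})) = card (Sigma A (\<lambda>v. R `` {v}))"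
      using finN by simp
    also have "\<dots> \<le> card {e \<in> touching A C. X e}"
    proof (rule card_arcs_le_edges[OF R(2)])
      show "finite {e \<in> touching A C. X e}" using finite_touching[OF that(3)] by simp
      show "Sigma A (\<lambda>v. R `` {v}) \<subseteq> R" by auto
      fix u v assume "(u, v) \<in> Sigma A (\<lambda>v. R `` {v})"
      then have uv: "u \<in> A" "(u, v) \<in> R" by auto
      have "v \<in> C" using uv that(2) by blast
      moreover have "X {u, v}" using uv(2) XR by blast
      ultimately show "{u, v} \<in> {e \<in> touching A C. X e}"
        using uv(1) that(1) ne[OF uv(2)] by (auto simp: touching_def)
    qed
    finally show ?thesis by (rule of_nat_mono)
  qed
  show False
  proof (rule degree_conditions_contradiction[of ?V R p])
    show "finite ?V" "R \<subseteq> ?V \<times> ?V" "0 < p" "p \<le> 1 / 4" "real (card ?V) * p \<ge> 1000"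
      using R p np by simp_all
  next
    fix v assume v: "v \<in> ?V"
    \<comment> \<open>Every edge at \<open>v\<close> is oriented out of or into
      \<open>v\<close>.\<close>
    have "{e \<in> touching {v} ?V. X e} \<subseteq> (\<lambda>w. {v, w}) ` (R `` {v} \<union> R\<inverse> `` {v})"
    proof
      fix e assume "e \<in> {e \<in> touching {v} ?V. X e}"
      then have e: "card e = 2" "v \<in> e" "X e" by (auto simp: touching_def)
      then obtain w where "e = {v, w}" by (auto simp: card_2_iff)
      then show "e \<in> (\<lambda>w. {v, w}) ` (R `` {v} \<union> R\<inverse> `` {v})" using e XR by auto
    qed
    then have "card {e \<in> touching {v} ?V. X e} \<le> card (R `` {v} \<union> R\<inverse> `` {v})"
      using finN by (intro surj_card_le) auto
    also have "\<dots> \<le> card (R `` {v}) + card (R\<inverse> `` {v})" by (rule card_Un_le)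
    finally have le: "card {e \<in> touching {v} ?V. X e} \<le> card (R `` {v}) + card (R\<inverse> `` {v})" .
    \<comment> \<open>The third \<epsilon> pays for n - 1 in place of n; this amounts to n \<ge> (1
      - \<epsilon>) / \<epsilon> = 999.\<close>
    have "(1 - 3 * \<epsilon>) * (n * p) \<le> (1 - \<epsilon>) * p * (real n - 1) - \<epsilon> * n * p"
    proof -
      have "n * p \<le> n * (1 / 4)" using p by (intro mult_left_mono) auto
      then have "999 \<le> real n" using np by linarith
      then have "999 * p \<le> real n * p" using p by (intro mult_right_mono) auto
      then show ?thesis by (simp add: \<epsilon>_def algebra_simps)
    qed
    also have "real n - 1 = real (card (touching {v} ?V))"
      using v by (subst card_touching) auto
    also note lower[OF v]
    also have "real (card {e \<in> touching {v} ?V. X e}) \<le> real (card (R `` {v}) + card (R\<inverse> `` {v}))"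
      using le by (rule of_nat_mono)
    finally show "(1 - 3 * (1 / 1000)) * (real (card ?V) * p)
        \<le> real (card (R `` {v}) + card (R\<inverse> `` {v}))"
      by (simp add: \<epsilon>_def)
  next
    fix T assume T: "T \<subseteq> ?V"
    show "real (\<Sum>v\<in>T. card (R `` {v})) \<le> (1 + 1 / 1000) * p *
         (real (card T) * real (card ?V) - (real (card T))\<^sup>2 / 2)
         + 1 / 1000 * (real (card ?V) * p) * real (card T)"
    \<comment> \<open>The strict inequality in \<open>edge_regular\<close> is available for nonempty
      sets only.\<close>
    proof (cases "T = {}")
      case False
      have "real (\<Sum>v\<in>T. card (R `` {v})) \<le> real (card {e \<in> touching T ?V. X e})"
        by (rule out_sum[OF T Image_subset[OF R(1)]]) simp
      also have "\<dots> \<le> (1 + \<epsilon>) * p * real (card (touching T ?V)) + \<epsilon> * n * p * real (card T)"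
        using upper[of T ?V] False T by simp
      also have "\<dots> \<le> (1 + \<epsilon>) * p * (real (card T) * n - (real (card T))\<^sup>2 / 2)
          + \<epsilon> * n * p * real (card T)"
        using p card_touching[OF _ T] by (intro add_right_mono mult_left_mono) (simp_all add: \<epsilon>_def)
      finally show ?thesis by (simp add: \<epsilon>_def mult_ac)
    qed simp
  next
    fix v assume v: "v \<in> ?V"
    let ?A = "R `` {v}"
    obtain B where B: "B \<subseteq> ?V" "card B < card ?A" "R `` ?A \<subseteq> ?A \<union> B"
      using B[OF v] by blast
    let ?C = "?A \<union> B"
    have A: "?A \<noteq> {}" "?A \<subseteq> ?V" using B(2) R(1) by auto
    have C: "finite ?C" "?C \<subseteq> ?V" using A(2) B(1) by (auto intro: finite_subset)
    have cC: "card ?C \<le> 2 * card ?A" using card_Un_le[of ?A B] B(2) by simp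
    have "real (\<Sum>w\<in>?A. card (R `` {w})) \<le> real (card {e \<in> touching ?A ?C. X e})"
      by (rule out_sum) (use B(3) C(1) in auto)
    also have "\<dots> \<le> (1 + \<epsilon>) * p * real (card (touching ?A ?C)) + \<epsilon> * n * p * real (card ?A)"
      using upper[of ?A ?C] A(1) C(2) cC by simp
    also have "\<dots> \<le> (1 + \<epsilon>) * p * (3 / 2 * (real (card ?A))\<^sup>2) + \<epsilon> * n * p * real (card ?A)"
    proof (intro add_right_mono mult_left_mono)
      \<comment> \<open>The factor 3/2 is 2 - 1/2: \<open>card ?C\<close> is at most twice
        \<open>card ?A\<close>, and pairs inside \<open>?A\<close> count once.\<close>
      have "real (card ?A) * real (card ?C) \<le> real (card ?A) * (2 * real (card ?A))"
        using cC by (intro mult_left_mono) linarith+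
      then show "real (card (touching ?A ?C)) \<le> 3 / 2 * (real (card ?A))\<^sup>2"
        using card_touching[OF C(1), of ?A] by (simp add: power2_eq_square)
    qed (use p in \<open>simp add: \<epsilon>_def\<close>)
    finally show "real (\<Sum>w\<in>?A. card (R `` {w})) \<le> (1 + 1 / 1000) * p * (3 / 2 * (real (card ?A))\<^sup>2)
         + 1 / 1000 * (real (card ?V) * p) * real (card ?A)"
      by (simp add: \<epsilon>_def mult_ac)
  qed
qed

section \<open>The sparse regime: graphs without a diamond, K_4 minus one edge\<close>

definition diamond :: "'a \<times> 'a \<times> 'a \<times> 'a \<Rightarrow> 'a set set" where
  "diamond = (\<lambda>(u, x, y, z). {{u, x}, {u, y}, {u, z}, {x, y}, {y, z}})"

definition contains_diamond :: "'a set \<Rightarrow> ('a set \<Rightarrow> bool) \<Rightarrow> bool" where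
  "contains_diamond V X \<longleftrightarrow>
     (\<exists>u x y z. {u, x, y, z} \<subseteq> V \<and> distinct [u, x, y, z] \<and> (\<forall>e\<in>diamond (u, x, y, z). X e))"

text \<open>First moment bound: at most n^4 ordered quadruples, each spanning five prescribed edges
  with probability p^5.\<close>

lemma prob_contains_diamond:
  fixes n :: nat and p :: real
  assumes "0 \<le> p" "p \<le> 1"
  shows "measure_pmf.prob (Pi_pmf (pairs_upto n) False (\<lambda>_. bernoulli_pmf p))
           {X. contains_diamond {1..n} X} \<le> n ^ 4 * p ^ 5"
proof -
  define Q where "Q = {(u, x, y, z). {u, x, y, z} \<subseteq> {1..n} \<and> distinct [u, x, y, z]}"
  let ?P = "Pi_pmf (pairs_upto n) False (\<lambda>_. bernoulli_pmf p)"
  let ?W = "{1..n} \<times> {1..n} \<times> {1..n} \<times> {1..n}"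
  have Q: "Q \<subseteq> ?W" by (auto simp: Q_def)
  then have finQ: "finite Q" by (rule finite_subset) simp
  have "{X. contains_diamond {1..n} X} = (\<Union>t\<in>Q. {X. \<forall>e\<in>diamond t. X e})"
    unfolding contains_diamond_def Q_def by blast
  then have "measure_pmf.prob ?P {X. contains_diamond {1..n} X}
      = measure_pmf.prob ?P (\<Union>t\<in>Q. {X. \<forall>e\<in>diamond t. X e})"
    by simp
  also have "\<dots> \<le> (\<Sum>t\<in>Q. measure_pmf.prob ?P {X. \<forall>e\<in>diamond t. X e})"
    by (rule measure_UNION_le) (use finQ in auto)
  also have "\<dots> = (\<Sum>t\<in>Q. p ^ 5)"
  proof (rule sum.cong)
    fix t assume "t \<in> Q"
    then obtain u x y z where t: "t = (u, x, y, z)" "{u, x, y, z} \<subseteq> {1..n}" "distinct [u, x, y, z]"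
      by (auto simp: Q_def)
    then have "diamond t \<subseteq> pairs_upto n" "card (diamond t) = 5"
      by (auto simp: diamond_def pairs_upto_def doubleton_eq_iff)
    then show "measure_pmf.prob ?P {X. \<forall>e\<in>diamond t. X e} = p ^ 5"
      using prob_all_edges_Pi_pmf[OF finite_pairs_upto, of "diamond t" n p] assms(1,2) by simp
  qed simp
  also have "\<dots> = real (card Q) * p ^ 5" by simp
  also have "\<dots> \<le> real (card ?W) * p ^ 5"
    using assms(1) by (intro mult_right_mono of_nat_mono card_mono[OF _ Q]) simp_all
  also have "real (card ?W) = n ^ 4" by (simp add: eval_nat_numeral)
  finally show ?thesis .
qed

lemma no_diamond_imp_seymour_vertex:
  fixes n :: nat and p :: real
  assumes X: "X \<in> set_pmf (Pi_pmf (pairs_upto n) False (\<lambda>_. bernoulli_pmf p))"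
    and n: "n > 0"
    and nod: "\<not> contains_diamond {1..n} X"
    and D: "orientation (edge_graph n X) D"
  shows "\<exists>u. seymour_vertex (with_proj D) u"
proof (rule ccontr)
  assume no: "\<nexists>u. seymour_vertex (with_proj D) u"
  obtain R where R: "R \<subseteq> {1..n} \<times> {1..n}" "antisym R" "irrefl R"
    and XR: "\<And>u v. X {u, v} \<longleftrightarrow> (u, v) \<in> R \<or> (v, u) \<in> R"
    and B: "\<And>u. u \<in> {1..n} \<Longrightarrow>
       \<exists>B \<subseteq> {1..n}. card B < card (R `` {u}) \<and> R `` (R `` {u}) \<subseteq> R `` {u} \<union> B"
    using orientation_without_seymour_vertex[OF X D no] by blast
  have B': "\<exists>B. finite B \<and> card B < card (R `` {u}) \<and> R `` (R `` {u}) \<subseteq> R `` {u} \<union> B"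
    if "u \<in> {1..n}" for u
    using B[OF that] by (meson finite_atLeastAtMost finite_subset)
  obtain u x y z where d: "distinct [u, x, y, z]"
    "(u, x) \<in> R" "(u, y) \<in> R" "(u, z) \<in> R" "(x, y) \<in> R" "(y, z) \<in> R"
    by (rule diamond_of_no_seymour[OF _ _ R B']) (use n in auto)
  have "{u, x, y, z} \<subseteq> {1..n}" using d R(1) by auto
  moreover have "X {a, b}" if "(a, b) \<in> R" for a b
    using XR that by blast
  then have "\<forall>e\<in>diamond (u, x, y, z). X e"
    unfolding diamond_def using d by simp
  ultimately show False using nod d(1) unfolding contains_diamond_def by blast
qed

section \<open>Transfer to the random graph and passage to the limit\<close>

lemma prob_every_orientation_seymour_ge:
  assumes "\<And>X D. X \<in> set_pmf (Pi_pmf (pairs_upto n) False (\<lambda>_. bernoulli_pmf p)) \<Longrightarrow>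
      X \<notin> S \<Longrightarrow> orientation (edge_graph n X) D \<Longrightarrow> \<exists>u. seymour_vertex (with_proj D) u"
  shows "measure_pmf.prob (binomial_random_graph n p)
            {G. \<forall>D. orientation G D \<longrightarrow> (\<exists>u. seymour_vertex (with_proj D) u)}
         \<ge> 1 - measure_pmf.prob (Pi_pmf (pairs_upto n) False (\<lambda>_. bernoulli_pmf p)) S"
    (is "measure_pmf.prob _ ?E \<ge> 1 - measure_pmf.prob ?P S")
proof -
  have "1 - measure_pmf.prob ?P S = measure_pmf.prob ?P (- S)"
    using measure_pmf.prob_compl[of S ?P] by (simp add: Compl_eq_Diff_UNIV)
  \<comment> \<open>Only \<open>X\<close> in the support are known to encode simple graphs, so the
    event is cut down to the support.\<close>
  also have "\<dots> = measure_pmf.prob ?P (- S \<inter> set_pmf ?P)"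
    by (rule measure_Int_set_pmf[symmetric])
  also have "\<dots> \<le> measure_pmf.prob ?P (edge_graph n -` ?E)"
    by (rule measure_pmf.finite_measure_mono) (use assms in auto)
  also have "\<dots> = measure_pmf.prob (binomial_random_graph n p) ?E"
    by (simp add: binomial_random_graph_def edge_graph_def[abs_def])
  finally show ?thesis .
qed

theorem theorem2:
  fixes p :: "nat \<Rightarrow> real"
  assumes "\<And>n. 0 < p n \<and> p n < 1"
    and "limsup (\<lambda>n. ereal (p n)) < ereal (1 / 4)"
  shows "(\<lambda>n. measure_pmf.prob (binomial_random_graph n (p n))
            {G. \<forall>D. orientation G D \<longrightarrow> (\<exists>u. seymour_vertex (with_proj D) u)})
          \<longlonglongrightarrow> 1"
proof -
  let ?prob = "\<lambda>n. measure_pmf.prob (binomial_random_graph n (p n))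
            {G. \<forall>D. orientation G D \<longrightarrow> (\<exists>u. seymour_vertex (with_proj D) u)}"
  \<comment> \<open>In the dense regime \<open>n * p n\<close> exceeds the cutoff
    \<open>n powr (1 / 10)\<close>; using the cutoff instead makes the error independent of
    \<open>p\<close>. The first summand of \<open>err\<close> covers the sparse regime, the others
    the dense one.\<close>
  define y where "y = (\<lambda>n. exp (- ((1 / 1000)\<^sup>2 * real n powr (1 / 10) / 3)))"
  define err where "err = (\<lambda>n. n powr (-1 / 2) +
      (n * y n ^ 3 + ((1 + y n) ^ n - 1) + ((1 + y n) ^ n - 1)\<^sup>2))"
  have "eventually (\<lambda>n. ereal (p n) < ereal (1 / 4)) sequentially"
    by (rule Limsup_lessD[OF assms(2)])
  moreover have "eventually (\<lambda>n. real n powr (1 / 10) \<ge> 1000) sequentially"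
    by real_asymp
  ultimately have "eventually (\<lambda>n. 1 - err n \<le> ?prob n) sequentially"
    using eventually_gt_at_top[of 0]
  proof eventually_elim
    case (elim n)
    let ?P = "Pi_pmf (pairs_upto n) False (\<lambda>_. bernoulli_pmf (p n))"
    have p: "0 < p n" "p n \<le> 1" "p n \<le> 1 / 4" using assms(1)[of n] elim by auto
    have y: "0 < y n" by (simp add: y_def)
    then have pos: "n * y n ^ 3 + ((1 + y n) ^ n - 1) + ((1 + y n) ^ n - 1)\<^sup>2 \<ge> 0"
      by (simp add: one_le_power)
    show ?case
    proof (cases "n * p n \<le> n powr (1 / 10)")
      case True
      define S where "S = {X. contains_diamond {1..n} X}"
      have "measure_pmf.prob ?P S \<le> n ^ 4 * p n ^ 5"
        unfolding S_def using p by (intro prob_contains_diamond) auto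
      \<comment> \<open>The bound tends to 0 below any cutoff n^a with a < 1/5; 1/10 is one such
        exponent.\<close>
      also have "\<dots> = (n * p n) ^ 5 / n"
        using elim by (simp add: power_mult_distrib eval_nat_numeral)
      also have "\<dots> \<le> (n powr (1 / 10)) ^ 5 / n"
        using True p by (intro divide_right_mono power_mono) auto
      also have "\<dots> = n powr (1 / 2) / n powr 1"
        using elim by (simp add: powr_power powr_one)
      also have "\<dots> = n powr (-1 / 2)"
        by (simp only: powr_diff[symmetric]) simp
      finally have "measure_pmf.prob ?P S \<le> err n" using pos by (simp add: err_def)
      moreover have "1 - measure_pmf.prob ?P S \<le> ?prob n"
        by (rule prob_every_orientation_seymour_ge)
           (rule no_diamond_imp_seymour_vertex, use elim in \<open>auto simp: S_def\<close>)
      ultimately show ?thesis by linarith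
    next
      case False
      define S where "S = {X. \<not> edge_regular n (p n) (1 / 1000) X}"
      define y' where "y' = exp (- ((1 / 1000)\<^sup>2 * real n * p n / 3))"
      have y': "0 < y'" "y' \<le> y n" using False by (simp_all add: y_def y'_def)
      have "measure_pmf.prob ?P S \<le> n * y' ^ 3 + ((1 + y') ^ n - 1) + ((1 + y') ^ n - 1)\<^sup>2"
        unfolding S_def y'_def by (rule prob_not_edge_regular) (use p in auto)
      also have "\<dots> \<le> n * y n ^ 3 + ((1 + y n) ^ n - 1) + ((1 + y n) ^ n - 1)\<^sup>2"
        using y' by (intro add_mono mult_left_mono power_mono diff_right_mono)
                    (auto simp: one_le_power)
      finally have "measure_pmf.prob ?P S \<le> err n"
        unfolding err_def by (rule order_trans) simp
      moreover have "1 - measure_pmf.prob ?P S \<le> ?prob n"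
        by (rule prob_every_orientation_seymour_ge)
           (rule edge_regular_imp_seymour_vertex, use elim p False in \<open>auto simp: S_def\<close>)
      ultimately show ?thesis by linarith
    qed
  qed
  \<comment> \<open>\<open>y n\<close> decays faster than every power of \<open>n\<close>, so
    \<open>n * y n\<close> tends to 0 and \<open>(1 + y n) ^ n\<close> to 1.\<close>
  moreover have "(\<lambda>n. 1 - err n) \<longlonglongrightarrow> 1"
    unfolding err_def y_def by real_asymp
  ultimately show ?thesis
    by (intro tendsto_sandwich[of "\<lambda>n. 1 - err n" ?prob sequentially "\<lambda>_. 1" 1]) auto
qed

end
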